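(* In LP$^{\mathrm{MLN}}$ (i.e. with respect to semi-strong equivalence $\equiv_{s,s}$), the S-AD transformation is both SE-preserving and NSE-preserving.
   Context: Atoms are propositional. A rule $r$ is an expression $h_1\vee\cdots\vee h_k\leftarrow b_1,\dots,b_m,\mathit{not}\,c_1,\dots,\mathit{not}\,c_n$; write $H(r)$, $B^+(r)$, $B^-(r)$ for the sets of head, positive body and negative body atoms. A program is a finite set of rules. An interpretation $X$ satisfies $r$ iff $X\cap H(r)\neq\emptyset$ or $B^+(r)\not\subseteq X$ or $B^-(r)\cap X\neq\emptyset$. GL-reduct $P^X=\{H(r)\leftarrow B^+(r) : r\in P,\ B^-(r)\cap X=\emptyset\}$; $X$ is an ASP stable model of $P$ iff $X\models P^X$ and no proper subset of $X$ satisfies $P^X$. Weights of LP$^{\mathrm{MLN}}$ rules are omitted; $X$ is an LP$^{\mathrm{MLN}}$ stable model of $P$ iff $X$ is an ASP stable model of $\{r\in P: X\models r\}$. $P\equiv_{s,s}Q$ iff for every program $R$, $P\cup R$ and $Q\cup R$ have the same LP$^{\mathrm{MLN}}$ stable models. Programs are regarded as tuples of rules; $\langle P,Q\rangle$ is the concatenation. For a tuple $T=\langle r_1,\dots,r_n\rangle$ with atom set $at(T)$, let $\langle S_1,\dots,S_{3n}\rangle=\langle H(r_1),B^+(r_1),B^-(r_1),\dots,H(r_n),B^+(r_n),B^-(r_n)\rangle$; for nonempty $N'\subseteq\{1,\dots,3n\}$ the independent set is $I_{N'}=\bigcap_{i\in N'}S_i\setminus\bigcup_{j\notin N'}S_j$.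 The S-AD transformation takes an independent set $I_{N'}$ with $|I_{N'}|\ge 2$ and a fresh atom $a'\notin at(T)$ and adds $a'$ to each $S_i$ with $i\in N'$. For a pair $T=\langle P,Q\rangle$ the result is $\langle P^+,Q^+\rangle$ with $P^+$ the first $|P|$ rules. A transformation type is SE-preserving if for every pair $\langle P,Q\rangle$ and every admissible application $P\equiv_{s,s}Q$ implies $P^+\equiv_{s,s}Q^+$, and NSE-preserving if $P\not\equiv_{s,s}Q$ implies $P^+\not\equiv_{s,s}Q^+$. *)

theory Defs
  imports Main "HOL-Library.FSet"
begin

datatype 'a rule = Rule (head: "'a fset") (pos: "'a fset") (neg: "'a fset")

definition sat_rule :: "'a set \<Rightarrow> 'a rule \<Rightarrow> bool" where
  "sat_rule X r \<longleftrightarrow>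
     X \<inter> fset (head r) \<noteq> {} \<or> \<not> fset (pos r) \<subseteq> X \<or> fset (neg r) \<inter> X \<noteq> {}"

definition sat :: "'a set \<Rightarrow> 'a rule set \<Rightarrow> bool" where
  "sat X P \<longleftrightarrow> (\<forall>r\<in>P. sat_rule X r)"

definition reduct :: "'a rule set \<Rightarrow> 'a set \<Rightarrow> 'a rule set" where
  "reduct P X = {Rule (head r) (pos r) {||} | r. r \<in> P \<and> fset (neg r) \<inter> X = {}}"

definition asp_stable :: "'a rule set \<Rightarrow> 'a set \<Rightarrow> bool" where
  "asp_stable P X \<longleftrightarrow> sat X (reduct P X) \<and> \<not> (\<exists>Y. Y \<subset> X \<and> sat Y (reduct P X))"

definition lpmln_stable :: "'a rule set \<Rightarrow> 'a set \<Rightarrow> bool" where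
  "lpmln_stable P X \<longleftrightarrow> asp_stable {r \<in> P. sat_rule X r} X"

definition semi_strong_equiv :: "'a rule set \<Rightarrow> 'a rule set \<Rightarrow> bool" where
  "semi_strong_equiv P Q \<longleftrightarrow>
     (\<forall>R. finite R \<longrightarrow> (\<forall>X. lpmln_stable (P \<union> R) X \<longleftrightarrow> lpmln_stable (Q \<union> R) X))"

text \<open>
  From here on programs are tuples (lists) of rules. The component sets are numbered from \<open>0\<close>:
  for the \<open>k\<close>-th rule \<open>r\<close>, the sets \<open>H(r)\<close>, \<open>B\<^sup>+(r)\<close>, \<open>B\<^sup>-(r)\<close> have
  numbers \<open>3k\<close>, \<open>3k + 1\<close>, \<open>3k + 2\<close>.
\<close>

definition components :: "'a rule list \<Rightarrow> 'a fset list" where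
  "components T = concat (map (\<lambda>r. [head r, pos r, neg r]) T)"

definition atoms :: "'a rule list \<Rightarrow> 'a set" where
  "atoms T = (\<Union>r\<in>set T. fset (head r) \<union> fset (pos r) \<union> fset (neg r))"

definition independent_set :: "'a rule list \<Rightarrow> nat set \<Rightarrow> 'a set" where
  "independent_set T N =
     (\<Inter>i\<in>N. fset (components T ! i)) -
     (\<Union>j\<in>{..<3 * length T} - N. fset (components T ! j))"

definition add_atom :: "nat set \<Rightarrow> 'a \<Rightarrow> 'a rule list \<Rightarrow> 'a rule list" where
  "add_atom N a T =
     (let add = (\<lambda>i S. if i \<in> N then finsert a S else S)
      in map (\<lambda>k. Rule (add (3 * k) (head (T ! k)))
                       (add (3 * k + 1) (pos (T ! k)))
                       (add (3 * k + 2) (neg (T ! k))))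
             [0..<length T])"

text \<open>
  A transformation type is the relation between a pair of programs and the pairs that result
  from its admissible applications.
\<close>

type_synonym 'a transformation =
  "'a rule list \<times> 'a rule list \<Rightarrow> 'a rule list \<times> 'a rule list \<Rightarrow> bool"

definition S_AD :: "'a transformation" where
  "S_AD = (\<lambda>(P, Q) (P', Q').
     \<exists>N a. N \<noteq> {} \<and> N \<subseteq> {..<3 * length (P @ Q)} \<and>
           card (independent_set (P @ Q) N) \<ge> 2 \<and>
           a \<notin> atoms (P @ Q) \<and>
           P' = take (length P) (add_atom N a (P @ Q)) \<and>
           Q' = drop (length P) (add_atom N a (P @ Q)))"

definition SE_preserving :: "'a transformation \<Rightarrow> bool" where
  "SE_preserving tr \<longleftrightarrow>
     (\<forall>P Q P' Q'. tr (P, Q) (P', Q') \<longrightarrow>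
        semi_strong_equiv (set P) (set Q) \<longrightarrow> semi_strong_equiv (set P') (set Q'))"

definition NSE_preserving :: "'a transformation \<Rightarrow> bool" where
  "NSE_preserving tr \<longleftrightarrow>
     (\<forall>P Q P' Q'. tr (P, Q) (P', Q') \<longrightarrow>
        \<not> semi_strong_equiv (set P) (set Q) \<longrightarrow> \<not> semi_strong_equiv (set P') (set Q'))"

end

theory Submission imports Defs begin

text \<open>
  Semi-strong equivalence of \<open>P\<close> and \<open>Q\<close> means that for all \<open>Y \<subseteq> X\<close> some rule of \<open>P\<close> is broken
  by \<open>(Y, X)\<close> iff some rule of \<open>Q\<close> is, where \<open>(Y, X)\<close> breaks \<open>r\<close> if \<open>X\<close> satisfies \<open>r\<close> but \<open>Y\<close> does
  not satisfy its reduct. Whether \<open>(Y, X)\<close> breaks \<open>r\<close> depends on each component set \<open>S\<close> of \<open>r\<close> only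
  through the conditions \<open>S \<inter> Z = {}\<close> and \<open>S \<subseteq> Z\<close> for \<open>Z\<close> among \<open>X\<close> and \<open>Y\<close>. Two atoms \<open>b \<noteq> c\<close> of
  the independent set and the new atom \<open>a\<close> occur in the same components after the transformation.
  For these conditions the three atoms matter only through the disjunction and the conjunction
  of their truth values, and the two atoms \<open>b\<close>, \<open>c\<close> alone can realise any such pair: this gives
  monotone maps of interpretations in both directions that preserve breaking.
\<close>

section \<open>Broken rules and semi-strong equivalence\<close>

definition breaks :: "'a rule \<Rightarrow> 'a set \<Rightarrow> 'a set \<Rightarrow> bool" where
  "breaks r Y X \<longleftrightarrow> fset (neg r) \<inter> X = {} \<and> fset (pos r) \<subseteq> Y \<and>
     fset (head r) \<inter> Y = {} \<and> fset (head r) \<inter> X \<noteq> {}"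

text \<open>If the reduct of \<open>r\<close> fails in \<open>Y\<close>, its positive body lies in
  \<open>Y\<close> and hence in \<open>X\<close>. So \<open>X\<close> can satisfy \<open>r\<close>
  only through the head, which is the last conjunct of \<open>breaks\<close>.\<close>

lemma sat_reduct_iff_not_breaks:
  assumes "Y \<subseteq> X"
  shows "sat Y (reduct {r \<in> P. sat_rule X r} X) \<longleftrightarrow> \<not> (\<exists>r\<in>P. breaks r Y X)"
proof -
  have sat: "sat Y (reduct P' X) \<longleftrightarrow>
      (\<forall>r\<in>P'. fset (neg r) \<inter> X = {} \<longrightarrow> sat_rule Y (Rule (head r) (pos r) {||}))" for P'
    unfolding sat_def reduct_def by blast
  have breaks: "\<not> breaks r Y X \<longleftrightarrow> (sat_rule X r \<longrightarrow> fset (neg r) \<inter> X = {} \<longrightarrow>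
      sat_rule Y (Rule (head r) (pos r) {||}))" for r
    using assms unfolding sat_rule_def breaks_def by auto
  show ?thesis
    by (simp add: sat breaks) blast
qed

text \<open>No head both meets and avoids \<open>X\<close>, so the rules that \<open>X\<close>
  satisfies always have \<open>X\<close> as a model of their reduct. Only minimality
  remains.\<close>

lemma lpmln_stable_iff_breaks:
  "lpmln_stable P X \<longleftrightarrow> (\<forall>Y. Y \<subset> X \<longrightarrow> (\<exists>r\<in>P. breaks r Y X))"
proof -
  have "\<not> (\<exists>r\<in>P. breaks r X X)"
    by (auto simp: breaks_def)
  then show ?thesis
    unfolding lpmln_stable_def asp_stable_def
    by (simp add: sat_reduct_iff_not_breaks psubset_imp_subset cong: conj_cong)
qed

lemma breaks_inter_atoms:
  assumes "fset (head r) \<union> fset (pos r) \<union> fset (neg r) \<subseteq> A"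
  shows "breaks r (Y \<inter> A) (X \<inter> A) \<longleftrightarrow> breaks r Y X"
proof -
  have "S \<inter> (Z \<inter> A) = S \<inter> Z" "S \<subseteq> Z \<inter> A \<longleftrightarrow> S \<subseteq> Z" if "S \<subseteq> A" for S Z
    using that by auto
  then show ?thesis
    using assms by (simp add: breaks_def)
qed

text \<open>
  The separating program consists of the facts in \<open>Y\<close> and all implications between atoms of
  \<open>X - Y\<close>, so that no set strictly between \<open>Y\<close> and \<open>X\<close> satisfies it.
\<close>

lemma semi_strong_equiv_imp_breaks_finite:
  assumes eq: "semi_strong_equiv P Q" and fin: "finite X" and sub: "Y \<subseteq> X"
    and r: "r \<in> Q" "breaks r Y X"
  shows "\<exists>r\<in>P. breaks r Y X"
proof (rule ccontr)
  assume none: "\<not> (\<exists>r\<in>P. breaks r Y X)"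
  have "Y \<subset> X"
    using r sub by (auto simp: breaks_def)
  define R where "R = (\<lambda>x. Rule {|x|} {||} {||}) ` Y \<union>
    (\<lambda>(x, y). Rule {|x|} {|y|} {||}) ` ((X - Y) \<times> (X - Y))"
  have "finite R"
    using fin sub by (auto simp: R_def finite_subset)
  have "\<not> (\<exists>r\<in>P \<union> R. breaks r Y X)"
    using none by (auto simp: R_def breaks_def)
  then have "\<not> lpmln_stable (P \<union> R) X"
    using \<open>Y \<subset> X\<close> by (auto simp: lpmln_stable_iff_breaks)
  moreover have "lpmln_stable (Q \<union> R) X"
    unfolding lpmln_stable_iff_breaks
  proof (intro allI impI)
    fix Z assume "Z \<subset> X"
    consider "Z = Y" | x where "x \<in> Y" "x \<notin> Z" | x y where "x \<in> X - Y" "y \<in> X - Y" "x \<notin> Z" "y \<in> Z"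
      using \<open>Z \<subset> X\<close> by blast
    then show "\<exists>r\<in>Q \<union> R. breaks r Z X"
    proof cases
      case 1
      then show ?thesis using r by auto
    next
      case 2
      then have "Rule {|x|} {||} {||} \<in> R" "breaks (Rule {|x|} {||} {||}) Z X"
        using sub by (auto simp: R_def breaks_def)
      then show ?thesis by blast
    next
      case 3
      then have "Rule {|x|} {|y|} {||} \<in> R" "breaks (Rule {|x|} {|y|} {||}) Z X"
        by (auto simp: R_def breaks_def)
      then show ?thesis by blast
    qed
  qed
  ultimately show False
    using eq \<open>finite R\<close> by (auto simp: semi_strong_equiv_def)
qed

text \<open>A separating program must be finite, but \<open>X\<close> may be infinite. Cutting both
  interpretations down to the finitely many atoms of the two programs leaves breaking
  unchanged.\<close>

lemma semi_strong_equiv_imp_breaks: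
  assumes "semi_strong_equiv P Q" "finite P" "finite Q" "Y \<subseteq> X" "r \<in> Q" "breaks r Y X"
  shows "\<exists>r\<in>P. breaks r Y X"
proof -
  define A where "A = (\<Union>r\<in>P \<union> Q. fset (head r) \<union> fset (pos r) \<union> fset (neg r))"
  have "finite A"
    using assms by (auto simp: A_def)
  have restrict: "breaks s (Y \<inter> A) (X \<inter> A) \<longleftrightarrow> breaks s Y X" if "s \<in> P \<union> Q" for s
    using that by (intro breaks_inter_atoms) (auto simp: A_def)
  have "\<exists>r\<in>P. breaks r (Y \<inter> A) (X \<inter> A)"
    using assms \<open>finite A\<close> restrict
    by (intro semi_strong_equiv_imp_breaks_finite[of P Q _ _ r]) auto
  then show ?thesis
    using restrict by blast
qed

lemma semi_strong_equiv_iff_breaks: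
  assumes "finite P" "finite Q"
  shows "semi_strong_equiv P Q \<longleftrightarrow>
    (\<forall>X Y. Y \<subseteq> X \<longrightarrow> ((\<exists>r\<in>P. breaks r Y X) \<longleftrightarrow> (\<exists>r\<in>Q. breaks r Y X)))"
    (is "_ \<longleftrightarrow> ?same")
proof
  assume eq: "semi_strong_equiv P Q"
  then have "semi_strong_equiv Q P"
    by (auto simp: semi_strong_equiv_def)
  with eq show ?same
    using assms semi_strong_equiv_imp_breaks[of P Q] semi_strong_equiv_imp_breaks[of Q P] by blast
next
  assume ?same
  then show "semi_strong_equiv P Q"
    unfolding semi_strong_equiv_def lpmln_stable_iff_breaks bex_Un
    by (simp add: psubset_imp_subset)
qed

text \<open>Monotonicity keeps \<open>g Y\<close> below \<open>g X\<close>, so the criterion for the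
  \<open>f\<close>-images can be evaluated at that pair and read back at
  \<open>(Y, X)\<close>.\<close>

lemma semi_strong_equiv_image_transfer:
  assumes "finite P" "finite Q" and "mono g"
    and breaks: "\<And>r Y X. r \<in> P \<union> Q \<Longrightarrow> breaks (f' r) Y X \<longleftrightarrow> breaks (f r) (g Y) (g X)"
    and "semi_strong_equiv (f ` P) (f ` Q)"
  shows "semi_strong_equiv (f' ` P) (f' ` Q)"
proof -
  have "(\<exists>r\<in>P. breaks (f' r) Y X) \<longleftrightarrow> (\<exists>r\<in>Q. breaks (f' r) Y X)" if "Y \<subseteq> X" for Y X
  proof -
    have "g Y \<subseteq> g X"
      using \<open>mono g\<close> that by (rule monoD)
    then have "(\<exists>r\<in>P. breaks (f r) (g Y) (g X)) \<longleftrightarrow> (\<exists>r\<in>Q. breaks (f r) (g Y) (g X))"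
      using assms(1,2,5) by (simp add: semi_strong_equiv_iff_breaks)
    then show ?thesis
      using breaks by auto
  qed
  then show ?thesis
    using assms(1,2) by (simp add: semi_strong_equiv_iff_breaks)
qed

section \<open>Duplicating an atom in every component\<close>

definition copy_atom :: "'a \<Rightarrow> 'a \<Rightarrow> 'a fset \<Rightarrow> 'a fset" where
  "copy_atom b a S = (if b |\<in>| S then finsert a S else S)"

definition copy_atom_rule :: "'a \<Rightarrow> 'a \<Rightarrow> 'a rule \<Rightarrow> 'a rule" where
  "copy_atom_rule b a r =
     Rule (copy_atom b a (head r)) (copy_atom b a (pos r)) (copy_atom b a (neg r))"

text \<open>The copy \<open>a\<close> takes the truth value of \<open>b\<close>; its former value is
  discarded.\<close>

definition extend_interp :: "'a \<Rightarrow> 'a \<Rightarrow> 'a set \<Rightarrow> 'a set" where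
  "extend_interp b a Z = (Z - {a}) \<union> {x. x = a \<and> b \<in> Z}"

text \<open>The atom \<open>b\<close> receives the disjunction and \<open>c\<close> the conjunction
  of the values of \<open>a\<close>, \<open>b\<close>, \<open>c\<close>. As the conjunction implies
  the disjunction, the new values of \<open>b\<close> and \<open>c\<close> have this same
  disjunction and conjunction.\<close>

definition contract_interp :: "'a \<Rightarrow> 'a \<Rightarrow> 'a \<Rightarrow> 'a set \<Rightarrow> 'a set" where
  "contract_interp b c a Z = (Z - {b, c}) \<union> {x. x = b \<and> Z \<inter> {a, b, c} \<noteq> {}} \<union>
     {x. x = c \<and> {a, b, c} \<subseteq> Z}"

lemma mono_extend_interp: "mono (extend_interp b a)"
  by (rule monoI) (auto simp: extend_interp_def)

lemma mono_contract_interp: "mono (contract_interp b c a)"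
  by (rule monoI) (auto simp: contract_interp_def)

lemma copy_atom_extend_interp:
  assumes "a |\<notin>| S"
  shows "fset (copy_atom b a S) \<inter> extend_interp b a Z = {} \<longleftrightarrow> fset S \<inter> Z = {}"
    and "fset (copy_atom b a S) \<subseteq> extend_interp b a Z \<longleftrightarrow> fset S \<subseteq> Z"
proof -
  let ?g = "extend_interp b a"
  have rest: "fset S \<inter> ?g Z = fset S \<inter> Z" "fset S \<subseteq> ?g Z \<longleftrightarrow> fset S \<subseteq> Z"
    using assms by (auto simp: extend_interp_def)
  have new: "a \<in> ?g Z \<longleftrightarrow> b \<in> Z"
    by (simp add: extend_interp_def)
  show "fset (copy_atom b a S) \<inter> ?g Z = {} \<longleftrightarrow> fset S \<inter> Z = {}"
    and "fset (copy_atom b a S) \<subseteq> ?g Z \<longleftrightarrow> fset S \<subseteq> Z"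
  proof (atomize(full), cases "b |\<in>| S")
    case True
    then have "fset (copy_atom b a S) = insert a (fset S)"
      by (simp add: copy_atom_def)
    with True show "(fset (copy_atom b a S) \<inter> ?g Z = {} \<longleftrightarrow> fset S \<inter> Z = {}) \<and>
        (fset (copy_atom b a S) \<subseteq> ?g Z \<longleftrightarrow> fset S \<subseteq> Z)"
      by (simp only: rest new Int_insert_left insert_subset split: if_split) blast
  qed (simp add: copy_atom_def rest)
qed

lemma copy_atom_contract_interp:
  assumes "b |\<in>| S \<longleftrightarrow> c |\<in>| S" "b \<noteq> c"
  shows "fset (copy_atom b a S) \<inter> Z = {} \<longleftrightarrow> fset S \<inter> contract_interp b c a Z = {}"
    and "fset (copy_atom b a S) \<subseteq> Z \<longleftrightarrow> fset S \<subseteq> contract_interp b c a Z"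
proof -
  let ?g = "contract_interp b c a"
  define S' where "S' = fset S - {b, c}"
  have rest: "S' \<inter> ?g Z = S' \<inter> Z" "S' \<subseteq> ?g Z \<longleftrightarrow> S' \<subseteq> Z"
    by (auto simp: S'_def contract_interp_def)
  have bc: "b \<in> ?g Z \<longleftrightarrow> a \<in> Z \<or> b \<in> Z \<or> c \<in> Z" "c \<in> ?g Z \<longleftrightarrow> a \<in> Z \<and> b \<in> Z \<and> c \<in> Z"
    using \<open>b \<noteq> c\<close> by (auto simp: contract_interp_def)
  show "fset (copy_atom b a S) \<inter> Z = {} \<longleftrightarrow> fset S \<inter> ?g Z = {}"
    and "fset (copy_atom b a S) \<subseteq> Z \<longleftrightarrow> fset S \<subseteq> ?g Z"
  proof (atomize(full), cases "b |\<in>| S")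
    case True
    then have S: "fset S = insert b (insert c S')"
      using assms by (auto simp: S'_def)
    have "fset (copy_atom b a S) = insert a (insert b (insert c S'))"
      using True S by (simp add: copy_atom_def)
    with S show "(fset (copy_atom b a S) \<inter> Z = {} \<longleftrightarrow> fset S \<inter> ?g Z = {}) \<and>
        (fset (copy_atom b a S) \<subseteq> Z \<longleftrightarrow> fset S \<subseteq> ?g Z)"
      by (simp only: rest bc Int_insert_left insert_subset split: if_split) blast
  next
    case False
    then have "fset S = S'" "fset (copy_atom b a S) = S'"
      using assms by (auto simp: S'_def copy_atom_def)
    then show "(fset (copy_atom b a S) \<inter> Z = {} \<longleftrightarrow> fset S \<inter> ?g Z = {}) \<and>
        (fset (copy_atom b a S) \<subseteq> Z \<longleftrightarrow> fset S \<subseteq> ?g Z)"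
      by (simp only: rest)
  qed
qed

lemma semi_strong_equiv_copy_atom_rule:
  assumes fin: "finite P" "finite Q" and "b \<noteq> c"
    and comps: "\<And>r S. r \<in> P \<union> Q \<Longrightarrow> S \<in> {head r, pos r, neg r} \<Longrightarrow>
      a |\<notin>| S \<and> (b |\<in>| S \<longleftrightarrow> c |\<in>| S)"
  shows "semi_strong_equiv (copy_atom_rule b a ` P) (copy_atom_rule b a ` Q) \<longleftrightarrow>
    semi_strong_equiv P Q"
proof
  assume eq: "semi_strong_equiv (copy_atom_rule b a ` P) (copy_atom_rule b a ` Q)"
  \<comment> \<open>The map \<open>id\<close> presents the original programs as images, the form
    that the transfer lemma expects.\<close>
  have extend: "breaks (id r) Y X \<longleftrightarrow>
      breaks (copy_atom_rule b a r) (extend_interp b a Y) (extend_interp b a X)"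
    if "r \<in> P \<union> Q" for r Y X
    using comps[OF that] by (simp add: breaks_def copy_atom_rule_def copy_atom_extend_interp)
  have "semi_strong_equiv (id ` P) (id ` Q)"
    by (rule semi_strong_equiv_image_transfer[OF fin mono_extend_interp extend eq])
  then show "semi_strong_equiv P Q"
    by simp
next
  assume "semi_strong_equiv P Q"
  then have eq: "semi_strong_equiv (id ` P) (id ` Q)"
    by simp
  have contract: "breaks (copy_atom_rule b a r) Y X \<longleftrightarrow>
      breaks (id r) (contract_interp b c a Y) (contract_interp b c a X)"
    if "r \<in> P \<union> Q" for r Y X
    using comps[OF that] \<open>b \<noteq> c\<close>
    by (simp add: breaks_def copy_atom_rule_def copy_atom_contract_interp[of b _ c])
  show "semi_strong_equiv (copy_atom_rule b a ` P) (copy_atom_rule b a ` Q)"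
    by (rule semi_strong_equiv_image_transfer[OF fin mono_contract_interp contract eq])
qed

section \<open>From component numbers to membership of an atom\<close>

lemma components_nth:
  assumes "k < length T"
  shows "components T ! (3 * k) = head (T ! k)"
    and "components T ! (3 * k + 1) = pos (T ! k)"
    and "components T ! (3 * k + 2) = neg (T ! k)"
proof -
  have "components T ! (3 * k) = head (T ! k) \<and> components T ! (3 * k + 1) = pos (T ! k) \<and>
      components T ! (3 * k + 2) = neg (T ! k)"
    using assms
  proof (induction T arbitrary: k)
    case (Cons r T)
    have "components (r # T) = head r # pos r # neg r # components T"
      by (simp add: components_def)
    then show ?case
      using Cons by (cases k) (auto simp: numeral_3_eq_3 numeral_2_eq_2)
  qed simp
  then show "components T ! (3 * k) = head (T ! k)" "components T ! (3 * k + 1) = pos (T ! k)"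
      "components T ! (3 * k + 2) = neg (T ! k)"
    by auto
qed

lemma independent_set_mem_component:
  assumes "b \<in> independent_set T N" "i < 3 * length T"
  shows "b |\<in>| components T ! i \<longleftrightarrow> i \<in> N"
  using assms by (auto simp: independent_set_def)

lemma independent_set_mem_iff:
  assumes "b \<in> independent_set T N" "k < length T"
  shows "b |\<in>| head (T ! k) \<longleftrightarrow> 3 * k \<in> N"
    and "b |\<in>| pos (T ! k) \<longleftrightarrow> 3 * k + 1 \<in> N"
    and "b |\<in>| neg (T ! k) \<longleftrightarrow> 3 * k + 2 \<in> N"
  using independent_set_mem_component[OF assms(1), of "3 * k"]
    independent_set_mem_component[OF assms(1), of "3 * k + 1"]
    independent_set_mem_component[OF assms(1), of "3 * k + 2"]
    components_nth[OF assms(2)] assms(2) by simp_all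

text \<open>A member \<open>b\<close> of the independent set lies in exactly the components numbered
  by \<open>N\<close>. Testing for \<open>b\<close> thus replaces testing the position, and the
  transformation acts on each rule separately.\<close>

lemma add_atom_eq_map_copy_atom_rule:
  assumes "b \<in> independent_set T N"
  shows "add_atom N a T = map (copy_atom_rule b a) T"
proof (rule nth_equalityI)
  show "add_atom N a T ! k = map (copy_atom_rule b a) T ! k" if "k < length (add_atom N a T)" for k
    using that independent_set_mem_iff[OF assms, of k]
    by (simp add: add_atom_def copy_atom_rule_def copy_atom_def Let_def)
qed (simp add: add_atom_def Let_def)

lemma semi_strong_equiv_S_AD:
  assumes "S_AD (P, Q) (P', Q')"
  shows "semi_strong_equiv (set P') (set Q') \<longleftrightarrow> semi_strong_equiv (set P) (set Q)"
proof -
  let ?T = "P @ Q"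
  obtain N a where two: "card (independent_set ?T N) \<ge> 2" and fresh: "a \<notin> atoms ?T"
    and P': "P' = take (length P) (add_atom N a ?T)"
    and Q': "Q' = drop (length P) (add_atom N a ?T)"
    using assms unfolding S_AD_def prod.case by blast
  obtain D where "D \<subseteq> independent_set ?T N" "card D = 2"
    using obtain_subset_with_card_n[OF two] by blast
  then obtain b c where b: "b \<in> independent_set ?T N" and c: "c \<in> independent_set ?T N" and "b \<noteq> c"
    unfolding card_2_iff by blast
  \<comment> \<open>A rulewise map commutes with cutting the concatenation back into its two
    programs.\<close>
  have images: "set P' = copy_atom_rule b a ` set P" "set Q' = copy_atom_rule b a ` set Q"
    by (simp_all add: P' Q' add_atom_eq_map_copy_atom_rule[OF b])
  have comps: "a |\<notin>| S \<and> (b |\<in>| S \<longleftrightarrow> c |\<in>| S)"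
    if "r \<in> set P \<union> set Q" "S \<in> {head r, pos r, neg r}" for r S
  proof -
    have "r \<in> set ?T"
      using that(1) by simp
    then obtain k where k: "k < length ?T" "r = ?T ! k"
      by (auto simp only: in_set_conv_nth)
    have "fset S \<subseteq> atoms ?T"
      using that by (auto simp: atoms_def)
    moreover have "b |\<in>| S \<longleftrightarrow> c |\<in>| S"
      using that(2) independent_set_mem_iff[OF b k(1)] independent_set_mem_iff[OF c k(1)]
      unfolding k(2) by blast
    ultimately show ?thesis
      using fresh by blast
  qed
  show ?thesis
    unfolding images
    by (rule semi_strong_equiv_copy_atom_rule[OF finite_set finite_set \<open>b \<noteq> c\<close> comps])
qed

theorem theorem5:
  "SE_preserving (S_AD :: 'a transformation) \<and> NSE_preserving (S_AD :: 'a transformation)"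
  unfolding SE_preserving_def NSE_preserving_def using semi_strong_equiv_S_AD by blast

end
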